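(* Let $\omega=e^{2\pi i/3}$ and define integers $E_3(n)$ by $$\varepsilon_3(q):=\sum_{n=0}^{\infty}E_3(n)q^n=\sum_{n=0}^{\infty}q^{3n}(q^{n+1};q)_{\infty}\left((\omega q^{n+1};q)_{\infty}+(\omega^{2}q^{n+1};q)_{\infty}\right).$$ Then $$\varepsilon_3(q)=2-q-2q^2+\sum_{n=2}^{\infty}(-1)^n\chi_3(n-1)\,q^{\binom{n+1}{2}+1},$$ where $\chi_3(n)=\omega^n+\omega^{-n}$, which equals $2$ if $3\mid n$ and $-1$ if $3\nmid n$.
   Context: For a complex $A$, $(A;q)_\infty=\prod_{i=0}^{\infty}(1-Aq^i)$, as a formal power series in $q$ (or for $|q|<1$). *)

theory Defs
  imports "HOL-Analysis.Analysis" "HOL-Computational_Algebra.Formal_Power_Series"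
begin

text \<open>
  The variable \<open>q\<close> is \<^term>\<open>fps_X :: complex fps\<close>. All infinite sums and products below are
  taken in the metric space of formal power series, i.e. in the \<open>q\<close>-adic topology.
\<close>

text \<open>
  The first argument is a power series and not just a complex number, since the symbol is
  used at arguments such as \<open>\<omega> q\<^sup>n\<^sup>+\<^sup>1\<close>.
\<close>

definition qpoch_inf :: "complex fps \<Rightarrow> complex fps" where
  "qpoch_inf A = (\<Prod>i. 1 - A * fps_X ^ i)"

definition omega :: complex where
  "omega = exp (2 * of_real pi * \<i> / 3)"

definition chi3 :: "int \<Rightarrow> complex" where
  "chi3 n = omega powi n + omega powi (- n)"

definition eps3_summand :: "nat \<Rightarrow> complex fps" where
  "eps3_summand n =
     fps_X ^ (3 * n) * qpoch_inf (fps_X ^ (n + 1)) *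
     (qpoch_inf (fps_const omega * fps_X ^ (n + 1)) +
      qpoch_inf (fps_const (omega ^ 2) * fps_X ^ (n + 1)))"

definition eps3 :: "complex fps" where
  "eps3 = (\<Sum>n. eps3_summand n)"

text \<open>
  The coefficients are defined as complex numbers; that they are integers is part of
  what has to be proved.
\<close>

definition E3 :: "nat \<Rightarrow> complex" where
  "E3 n = fps_nth eps3 n"

definition theta3_summand :: "nat \<Rightarrow> complex fps" where
  "theta3_summand n =
     (if n \<ge> 2 then (-1) ^ n * fps_const (chi3 (int n - 1)) * fps_X ^ ((n + 1 choose 2) + 1)
      else 0)"

end

theory Submission
  imports Defs
begin

text \<open>
  Write \<open>T k = (k + 1 choose 2)\<close>. Euler's expansion gives
  \<open>(z q\<^sup>n\<^sup>+\<^sup>1; q)\<^sub>\<infinity> = (\<Sum>k. (-z)\<^sup>k q\<^bsup>T k + n k\<^esup> / (q; q)\<^sub>k)\<close>. Interchanging the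
  summations over \<open>n\<close> and \<open>k\<close> and using
  \<open>(\<Sum>n. q\<^bsup>m n\<^esup> (q\<^sup>n\<^sup>+\<^sup>1; q)\<^sub>\<infinity>) = (q; q)\<^bsub>m - 1\<^esub>\<close> for \<open>m = k + 3\<close> yields
  \<open>(\<Sum>n. q\<^bsup>3 n\<^esup> (q\<^sup>n\<^sup>+\<^sup>1; q)\<^sub>\<infinity> (z q\<^sup>n\<^sup>+\<^sup>1; q)\<^sub>\<infinity>)
    = (\<Sum>k. (-z)\<^sup>k q\<^bsup>T k\<^esup> (1 - q\<^sup>k\<^sup>+\<^sup>1) (1 - q\<^sup>k\<^sup>+\<^sup>2))\<close>.
  Expanding the product gives the exponents \<open>T k\<close>, \<open>T (k + 1)\<close>, \<open>T (k + 1) + 1\<close> and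
  \<open>T (k + 2)\<close>. For \<open>m \<ge> 2\<close> the coefficient of \<open>q\<^bsup>T m\<^esup>\<close> has the factor \<open>1 + z + z\<^sup>2\<close>, which
  vanishes for the primitive third roots of unity, so that only the terms with exponents
  \<open>T m + 1\<close> survive.
\<close>

subsection \<open>Convergent sums of formal power series\<close>

lemma fps_X_power_dvd_iff:
  fixes f :: "'a::comm_ring_1 fps"
  shows "fps_X ^ n dvd f \<longleftrightarrow> (\<forall>i<n. fps_nth f i = 0)"
proof
  assume "fps_X ^ n dvd f"
  then show "\<forall>i<n. fps_nth f i = 0"
    by (auto elim!: dvdE simp: fps_X_power_mult_nth)
next
  assume "\<forall>i<n. fps_nth f i = 0"
  then have "fps_cutoff n f = 0"
    by (simp add: fps_eq_iff)
  then show "fps_X ^ n dvd f"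
    using fps_shift_cutoff'[of n f] by (metis add.right_neutral dvd_triv_left)
qed

lemma fps_nth_dvd_eq_0:
  fixes f :: "'a::comm_ring_1 fps"
  assumes "fps_X ^ n dvd f" "i < n"
  shows "fps_nth f i = 0"
  using assms by (auto simp: fps_X_power_dvd_iff)

lemma sum_fps_nth_eq:
  fixes f :: "nat \<Rightarrow> 'a::comm_ring_1 fps"
  assumes "\<And>n. fps_X ^ n dvd f n" "i \<le> N"
  shows "(\<Sum>n\<le>N. fps_nth (f n) i) = (\<Sum>n\<le>i. fps_nth (f n) i)"
proof (rule sum.mono_neutral_right)
  show "\<forall>n\<in>{..N} - {..i}. fps_nth (f n) i = 0"
    using fps_nth_dvd_eq_0[OF assms(1)] by (simp add: not_le)
qed (use assms(2) in simp_all)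

text \<open>The order bound \<open>fps_X ^ n dvd f n\<close> is the convergence criterion used
  throughout: coefficient \<open>i\<close> of the partial sums no longer changes from
  \<open>N = i\<close> on.\<close>

lemma fps_sums_Abs:
  fixes f :: "nat \<Rightarrow> 'a::comm_ring_1 fps"
  assumes "\<And>n. fps_X ^ n dvd f n"
  shows "f sums Abs_fps (\<lambda>i. \<Sum>n\<le>i. fps_nth (f n) i)"
  unfolding sums_def_le
proof (rule tendsto_fpsI)
  fix i
  show "\<forall>\<^sub>F N in sequentially. fps_nth (\<Sum>n\<le>N. f n) i
      = fps_nth (Abs_fps (\<lambda>i. \<Sum>n\<le>i. fps_nth (f n) i)) i"
    using eventually_ge_at_top[of i]
  proof eventually_elim
    case (elim N)
    show ?case
      using sum_fps_nth_eq[OF assms elim] by (simp add: fps_sum_nth)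
  qed
qed

lemma fps_summable:
  fixes f :: "nat \<Rightarrow> 'a::comm_ring_1 fps"
  assumes "\<And>n. fps_X ^ n dvd f n"
  shows "summable f"
  using fps_sums_Abs[OF assms] by (rule sums_summable)

lemma fps_suminf_nth:
  fixes f :: "nat \<Rightarrow> 'a::comm_ring_1 fps"
  assumes "\<And>n. fps_X ^ n dvd f n"
  shows "fps_nth (suminf f) i = (\<Sum>n\<le>i. fps_nth (f n) i)"
  using sums_unique[OF fps_sums_Abs[OF assms], symmetric] by simp

lemma fps_suminf_add:
  fixes f g :: "nat \<Rightarrow> 'a::comm_ring_1 fps"
  assumes "\<And>n. fps_X ^ n dvd f n" "\<And>n. fps_X ^ n dvd g n"
  shows "(\<Sum>n. f n + g n) = suminf f + suminf g"
  by (rule fps_ext) (simp add: fps_suminf_nth assms sum.distrib dvd_add)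

lemma fps_suminf_mult:
  fixes f :: "nat \<Rightarrow> 'a::comm_ring_1 fps"
  assumes "\<And>n. fps_X ^ n dvd f n"
  shows "(\<Sum>n. c * f n) = c * suminf f"
proof (rule fps_ext)
  fix i
  \<comment> \<open>Raising the cut-off from \<open>i - j\<close> to \<open>i\<close> makes it
    independent of \<open>j\<close>, so that the two finite sums can be swapped.\<close>
  have "fps_nth (suminf f) (i - j) = (\<Sum>n\<le>i. fps_nth (f n) (i - j))" for j
    by (simp add: fps_suminf_nth assms sum_fps_nth_eq[OF assms, of "i - j" i])
  then have "fps_nth (c * suminf f) i
      = (\<Sum>j=0..i. fps_nth c j * (\<Sum>n\<le>i. fps_nth (f n) (i - j)))"
    by (simp add: fps_mult_nth)
  also have "\<dots> = (\<Sum>n\<le>i. fps_nth (c * f n) i)"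
    unfolding fps_mult_nth sum_distrib_left by (rule sum.swap)
  also have "\<dots> = fps_nth (\<Sum>n. c * f n) i"
    by (simp add: fps_suminf_nth assms)
  finally show "fps_nth (\<Sum>n. c * f n) i = fps_nth (c * suminf f) i" ..
qed

lemma fps_suminf_diff:
  fixes f g :: "nat \<Rightarrow> 'a::comm_ring_1 fps"
  assumes "\<And>n. fps_X ^ n dvd f n" "\<And>n. fps_X ^ n dvd g n"
  shows "(\<Sum>n. f n - g n) = suminf f - suminf g"
  by (rule fps_ext) (simp add: fps_suminf_nth assms sum_subtractf dvd_diff)

lemma fps_suminf_split_head:
  fixes f :: "nat \<Rightarrow> 'a::comm_ring_1 fps"
  assumes "\<And>n. fps_X ^ n dvd f n"
  shows "suminf f = f 0 + (\<Sum>n. f (Suc n))"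
proof (rule fps_ext)
  fix i
  have *: "fps_X ^ n dvd f (Suc n)" for n
    using assms[of "Suc n"] by (metis dvd_trans le_imp_power_dvd le_SucI order_refl)
  \<comment> \<open>The added term \<open>f (Suc i)\<close> has order above \<open>i\<close>; with
    it the range matches the shifted sum.\<close>
  have "(\<Sum>n\<le>i. fps_nth (f n) i) = (\<Sum>n\<le>Suc i. fps_nth (f n) i)"
    using assms by (simp add: fps_nth_dvd_eq_0[OF assms])
  also have "\<dots> = fps_nth (f 0) i + (\<Sum>n\<le>i. fps_nth (f (Suc n)) i)"
    by (rule sum.atMost_Suc_shift)
  finally show "fps_nth (suminf f) i = fps_nth (f 0 + (\<Sum>n. f (Suc n))) i"
    by (simp add: fps_suminf_nth assms *)
qed

text \<open>With order bounds in both indices, coefficient \<open>i\<close> only sees the finite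
  square of indices up to \<open>i\<close>.\<close>

lemma fps_suminf_swap:
  fixes f :: "nat \<Rightarrow> nat \<Rightarrow> 'a::comm_ring_1 fps"
  assumes n: "\<And>n k. fps_X ^ n dvd f n k" and k: "\<And>n k. fps_X ^ k dvd f n k"
  shows "(\<Sum>n. \<Sum>k. f n k) = (\<Sum>k. \<Sum>n. f n k)"
proof (rule fps_ext)
  fix i
  have 1: "fps_X ^ n dvd (\<Sum>k. f n k)" for n
    using fps_nth_dvd_eq_0[OF n] by (simp add: fps_X_power_dvd_iff fps_suminf_nth[OF k])
  have 2: "fps_X ^ k dvd (\<Sum>n. f n k)" for k
    using fps_nth_dvd_eq_0[OF k] by (simp add: fps_X_power_dvd_iff fps_suminf_nth[OF n])
  show "fps_nth (\<Sum>n. \<Sum>k. f n k) i = fps_nth (\<Sum>k. \<Sum>n. f n k) i"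
    by (simp add: fps_suminf_nth 1 2 n k) (rule sum.swap)
qed

lemma fps_eq_suminf_nth:
  fixes f :: "'a::comm_ring_1 fps"
  shows "f = (\<Sum>n. fps_const (fps_nth f n) * fps_X ^ n)"
  by (rule fps_ext) (simp add: fps_suminf_nth if_distrib cong: if_cong)

subsection \<open>Infinite products\<close>

lemma convergent_prod_qpoch:
  fixes A :: "'a::idom fps"
  shows "convergent_prod (\<lambda>i. 1 - A * fps_X ^ i)"
proof -
  \<comment> \<open>The factor \<open>1 - A\<close> is left out because it may vanish, as for
    \<open>A = 1\<close>. The others have constant term 1, so their product has a nonzero
    limit.\<close>
  define P where "P = (\<lambda>N. \<Prod>i\<le>N. 1 - A * fps_X ^ (i + 1))"
  have P_nth: "fps_nth (P N) n = fps_nth (P n) n" if "n \<le> N" for n N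
    using that
  proof (induction N rule: nat_induct_at_least)
    case (Suc N)
    have "P (Suc N) = P N - fps_X ^ (N + 2) * (A * P N)"
      by (simp add: P_def algebra_simps)
    moreover have "fps_nth (fps_X ^ (N + 2) * (A * P N)) n = 0"
      using Suc.hyps by (intro fps_nth_dvd_eq_0[OF dvd_triv_left]) simp
    ultimately show ?case
      using Suc.IH by (simp only: fps_sub_nth diff_zero)
  qed simp
  define L where "L = Abs_fps (\<lambda>n. fps_nth (P n) n)"
  have "P \<longlonglongrightarrow> L"
  proof (rule tendsto_fpsI)
    fix n
    show "\<forall>\<^sub>F N in sequentially. fps_nth (P N) n = fps_nth L n"
      using eventually_ge_at_top[of n] unfolding L_def fps_nth_Abs_fps
      by eventually_elim (rule P_nth)
  qed
  moreover have "fps_nth L 0 = 1"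
    by (simp add: L_def P_def)
  ultimately have "raw_has_prod (\<lambda>i. 1 - A * fps_X ^ i) 1 L"
    by (auto simp: raw_has_prod_def P_def)
  then show ?thesis
    by (auto simp: convergent_prod_def)
qed

text \<open>Iterating the functional equation splits off finite products, and the remaining factor
  \<open>F (Suc N)\<close> tends to 1.\<close>

lemma qpoch_inf_eqI:
  assumes rec: "\<And>n. F n = (1 - A * fps_X ^ n) * F (Suc n)"
    and F: "\<And>n. fps_X ^ Suc n dvd F n - 1"
  shows "qpoch_inf A = F 0"
proof -
  have prod: "F 0 = (\<Prod>i\<le>N. 1 - A * fps_X ^ i) * F (Suc N)" for N
  proof (induction N)
    case 0
    show ?case using rec[of 0] by simp
  next
    case (Suc N)
    then show ?case using rec[of "Suc N"] by (simp add: mult.assoc)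
  qed
  have "(\<lambda>N. \<Prod>i\<le>N. 1 - A * fps_X ^ i) \<longlonglongrightarrow> F 0"
  proof (rule tendsto_fpsI)
    fix n
    show "\<forall>\<^sub>F N in sequentially. fps_nth (\<Prod>i\<le>N. 1 - A * fps_X ^ i) n = fps_nth (F 0) n"
      using eventually_ge_at_top[of n]
    proof eventually_elim
      case (elim N)
      have "F 0 - (\<Prod>i\<le>N. 1 - A * fps_X ^ i)
          = (\<Prod>i\<le>N. 1 - A * fps_X ^ i) * (F (Suc N) - 1)"
        by (subst prod[of N]) (simp add: algebra_simps)
      then have "fps_X ^ Suc (Suc N) dvd F 0 - (\<Prod>i\<le>N. 1 - A * fps_X ^ i)"
        by (simp add: F del: power_Suc)
      from fps_nth_dvd_eq_0[OF this, of n] elim show ?case by simp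
    qed
  qed
  moreover have "F 0 \<noteq> 0"
    using fps_nth_dvd_eq_0[OF F, of 0 0] by auto
  ultimately have "(\<lambda>i. 1 - A * fps_X ^ i) has_prod F 0"
    by (simp add: has_prod_def raw_has_prod_def)
  then show ?thesis
    unfolding qpoch_inf_def by (metis has_prod_unique)
qed

subsection \<open>Euler's expansion\<close>

lemma Suc_Suc_choose_2: "Suc (Suc k) choose 2 = (Suc k choose 2) + Suc k"
  by (simp add: numeral_2_eq_2)

lemma Suc_choose_2_ge: "k \<le> Suc k choose 2"
  by (simp add: numeral_2_eq_2)

text \<open>The finite symbol \<open>(q; q)_k\<close>.\<close>

definition qfact :: "nat \<Rightarrow> complex fps" where
  "qfact k = (\<Prod>i<k. 1 - fps_X ^ Suc i)"

lemma qfact_Suc: "qfact (Suc k) = qfact k * (1 - fps_X ^ Suc k)"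
  by (simp add: qfact_def)

lemma qfact_nth_0: "fps_nth (qfact k) 0 = 1"
  by (induction k) (simp_all add: qfact_Suc, simp add: qfact_def)

lemma qfact_inverse: "qfact k * inverse (qfact k) = 1"
  by (simp add: inverse_mult_eq_1' qfact_nth_0)

text \<open>The \<open>k\<close>-th term of Euler's expansion of \<open>(c q^(n+1); q)_inf\<close>.
  Keeping \<open>n\<close> as a parameter turns the expansion into a family with a functional
  equation in \<open>n\<close>.\<close>

definition euler_summand :: "complex \<Rightarrow> nat \<Rightarrow> nat \<Rightarrow> complex fps" where
  "euler_summand c n k =
     fps_const ((- c) ^ k) * fps_X ^ ((Suc k choose 2) + n * k) * inverse (qfact k)"

lemma euler_summand_dvd: "fps_X ^ k dvd euler_summand c n k"
  unfolding euler_summand_def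
  by (intro dvd_mult2 dvd_mult le_imp_power_dvd) (use Suc_choose_2_ge[of k] in linarith)

definition euler_sum :: "complex \<Rightarrow> nat \<Rightarrow> complex fps" where
  "euler_sum c n = (\<Sum>k. euler_summand c n k)"

text \<open>The series of terms weighted by \<open>1 - fps_X ^ k\<close> is evaluated twice. The
  weight gives the difference of the terms for \<open>n\<close> and \<open>Suc n\<close>; it also
  cancels the last factor of \<open>qfact k\<close>, which shifts the index.\<close>

lemma euler_sum_rec:
  "euler_sum c n = (1 - fps_const c * fps_X ^ Suc n) * euler_sum c (Suc n)"
proof -
  have dvd: "fps_X ^ k dvd euler_summand c n k * (1 - fps_X ^ k)" for k
    by (intro dvd_mult2 euler_summand_dvd)
  have shift: "euler_summand c n (Suc k) * (1 - fps_X ^ Suc k)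
      = fps_const (- c) * fps_X ^ Suc n * euler_summand c (Suc n) k" for k
  proof -
    have "inverse (1 - fps_X ^ Suc k) * (1 - fps_X ^ Suc k) = (1 :: complex fps)"
      by (rule inverse_mult_eq_1) simp
    then have inv: "inverse (qfact (Suc k)) * (1 - fps_X ^ Suc k) = inverse (qfact k)"
      by (simp only: qfact_Suc fps_inverse_mult mult.assoc mult_1_right)
    have "euler_summand c n (Suc k) * (1 - fps_X ^ Suc k)
        = fps_const ((- c) ^ Suc k) * fps_X ^ ((Suc (Suc k) choose 2) + n * Suc k)
          * inverse (qfact k)"
      unfolding euler_summand_def by (simp only: mult.assoc inv)
    also have "(Suc (Suc k) choose 2) + n * Suc k = Suc n + ((Suc k choose 2) + Suc n * k)"
      by (simp add: Suc_Suc_choose_2)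
    also have "fps_const ((- c) ^ Suc k) = fps_const (- c) * fps_const ((- c) ^ k)"
      by simp
    finally show ?thesis
      unfolding euler_summand_def power_add by (simp only: ac_simps)
  qed
  have diff: "euler_summand c n k * (1 - fps_X ^ k)
      = euler_summand c n k - euler_summand c (Suc n) k" for k
    by (simp add: euler_summand_def algebra_simps power_add)
  have "euler_sum c n - euler_sum c (Suc n) = (\<Sum>k. euler_summand c n k * (1 - fps_X ^ k))"
    unfolding euler_sum_def diff by (rule fps_suminf_diff[symmetric]) (rule euler_summand_dvd)+
  also have "\<dots> = (\<Sum>k. euler_summand c n (Suc k) * (1 - fps_X ^ Suc k))"
    by (subst fps_suminf_split_head[OF dvd]) simp
  also have "\<dots> = fps_const (- c) * fps_X ^ Suc n * euler_sum c (Suc n)"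
    unfolding shift euler_sum_def by (rule fps_suminf_mult) (rule euler_summand_dvd)
  finally show ?thesis
    by (simp add: algebra_simps fps_const_neg[symmetric] del: fps_const_neg)
qed

text \<open>The term for \<open>k = 0\<close> is 1 and all others have order at least
  \<open>1 + n\<close>. This is the normalisation that \<open>qpoch_inf_eqI\<close> asks
  for.\<close>

lemma euler_sum_dvd: "fps_X ^ Suc n dvd euler_sum c n - 1"
proof -
  have "fps_nth (euler_sum c n) i = fps_nth 1 i" if "i < Suc n" for i
  proof -
    have "fps_nth (euler_summand c n k) i = 0" if "k > 0" for k
    proof (rule fps_nth_dvd_eq_0[OF _ \<open>i < Suc n\<close>])
      have "1 \<le> Suc k choose 2"
        using Suc_choose_2_ge[of k] that by linarith
      moreover have "n \<le> n * k"
        using that by simp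
      ultimately show "fps_X ^ Suc n dvd euler_summand c n k"
        unfolding euler_summand_def by (intro dvd_mult2 dvd_mult le_imp_power_dvd) linarith
    qed
    then have "(\<Sum>k\<le>i. fps_nth (euler_summand c n k) i)
        = (\<Sum>k\<in>{0}. fps_nth (euler_summand c n k) i)"
      by (intro sum.mono_neutral_right) auto
    then show ?thesis
      by (simp add: euler_sum_def fps_suminf_nth euler_summand_dvd)
         (simp add: euler_summand_def qfact_def numeral_2_eq_2)
  qed
  then show ?thesis
    unfolding fps_X_power_dvd_iff by simp
qed

lemma qpoch_inf_euler: "qpoch_inf (fps_const c * fps_X ^ Suc n) = euler_sum c n"
proof -
  \<comment> \<open>The form \<open>n + 0\<close> lets the rule take the function sending
    \<open>m\<close> to \<open>euler_sum c (n + m)\<close> as \<open>F\<close>.\<close>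
  have "qpoch_inf (fps_const c * fps_X ^ Suc n) = euler_sum c (n + 0)"
  proof (rule qpoch_inf_eqI)
    fix m
    show "euler_sum c (n + m)
        = (1 - fps_const c * fps_X ^ Suc n * fps_X ^ m) * euler_sum c (n + Suc m)"
      using euler_sum_rec[of c "n + m"] by (simp add: power_add mult.assoc)
    show "fps_X ^ Suc m dvd euler_sum c (n + m) - 1"
      by (rule dvd_trans[OF le_imp_power_dvd euler_sum_dvd]) simp
  qed
  then show ?thesis by simp
qed

lemma qpoch_inf_X: "qpoch_inf (fps_X ^ Suc n) = euler_sum 1 n"
  using qpoch_inf_euler[of 1 n] by simp

subsection \<open>Summation over the shift of the products\<close>

lemma X_power_mult_dvd: "0 < m \<Longrightarrow> fps_X ^ n dvd fps_X ^ (m * n) * (f :: 'a::comm_ring_1 fps)"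
  by (intro dvd_mult2 le_imp_power_dvd) simp

lemma euler_sum_1_rec: "fps_X ^ Suc n * euler_sum 1 (Suc n) = euler_sum 1 (Suc n) - euler_sum 1 n"
  using euler_sum_rec[of 1 n] by (simp add: algebra_simps)

text \<open>Induction on \<open>m\<close>, where \<open>Suc m\<close> keeps the exponent positive
  and the sum convergent. Writing \<open>G m\<close> for the sum with exponent \<open>m * n\<close>,
  the step shows \<open>G (m+1) - G (m+2) = q^(m+1) G (m+1)\<close>.\<close>

lemma suminf_X_power_euler_sum_1: "(\<Sum>n. fps_X ^ (Suc m * n) * euler_sum 1 n) = qfact m"
proof (induction m)
  case 0
  show ?case
  proof (rule fps_ext)
    fix i
    \<comment> \<open>The partial sums telescope to \<open>euler_sum 1 i\<close>, which agrees with
      1 up to degree \<open>i\<close>.\<close>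
    have "(\<Sum>n\<le>i. fps_X ^ n * euler_sum 1 n) = euler_sum 1 i"
    proof (induction i)
      case (Suc i)
      then show ?case using euler_sum_1_rec[of i] by simp
    qed simp
    moreover have "fps_nth (euler_sum 1 i) i = fps_nth 1 i"
      using fps_nth_dvd_eq_0[OF euler_sum_dvd[of i 1], of i] by simp
    ultimately show "fps_nth (\<Sum>n. fps_X ^ (Suc 0 * n) * euler_sum 1 n) i = fps_nth (qfact 0) i"
      by (simp add: fps_suminf_nth fps_sum_nth[symmetric] qfact_def)
  qed
next
  case (Suc m)
  let ?G = "\<lambda>m. \<Sum>n. fps_X ^ (m * n) * euler_sum 1 n"
  have step: "fps_X ^ (Suc m * Suc n) * euler_sum 1 (Suc n)
      - fps_X ^ (Suc (Suc m) * Suc n) * euler_sum 1 (Suc n)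
      = fps_X ^ Suc m * (fps_X ^ (Suc m * n) * euler_sum 1 n)" for n
  proof -
    have "euler_sum 1 n = (1 - fps_X ^ Suc n) * euler_sum 1 (Suc n)"
      using euler_sum_rec[of 1 n] by simp
    then show ?thesis
      by (elim ssubst) (simp add: algebra_simps power_add)
  qed
  have "?G (Suc m) - ?G (Suc (Suc m))
      = (\<Sum>n. fps_X ^ (Suc m * n) * euler_sum 1 n - fps_X ^ (Suc (Suc m) * n) * euler_sum 1 n)"
    by (rule fps_suminf_diff[symmetric]) (rule X_power_mult_dvd, simp)+
  also have "\<dots> = (\<Sum>n. fps_X ^ Suc m * (fps_X ^ (Suc m * n) * euler_sum 1 n))"
    by (subst fps_suminf_split_head)
       (intro dvd_diff X_power_mult_dvd zero_less_Suc, simp only: step mult_0_right diff_self add_0 power_0)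
  also have "\<dots> = fps_X ^ Suc m * ?G (Suc m)"
    by (rule fps_suminf_mult) (rule X_power_mult_dvd, simp)
  finally have "?G (Suc (Suc m)) = ?G (Suc m) * (1 - fps_X ^ Suc m)"
    by (simp add: algebra_simps)
  then show ?case
    by (simp only: Suc.IH qfact_Suc)
qed

lemma suminf_euler_product:
  "(\<Sum>n. fps_X ^ (3 * n) * euler_sum 1 n * euler_sum z n)
    = (\<Sum>k. fps_const ((- z) ^ k) * fps_X ^ (Suc k choose 2)
            * ((1 - fps_X ^ Suc k) * (1 - fps_X ^ Suc (Suc k))))"
proof -
  let ?t = "\<lambda>n k. fps_X ^ (3 * n) * euler_sum 1 n * euler_summand z n k"
  let ?d = "\<lambda>k. fps_const ((- z) ^ k) * fps_X ^ (Suc k choose 2) * inverse (qfact k)"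
  have "(\<Sum>n. fps_X ^ (3 * n) * euler_sum 1 n * euler_sum z n) = (\<Sum>n. \<Sum>k. ?t n k)"
    unfolding euler_sum_def[of z] by (simp add: fps_suminf_mult euler_summand_dvd)
  also have "\<dots> = (\<Sum>k. \<Sum>n. ?t n k)"
  proof (rule fps_suminf_swap)
    show "fps_X ^ n dvd ?t n k" for n k
      unfolding mult.assoc by (rule X_power_mult_dvd) simp
    show "fps_X ^ k dvd ?t n k" for n k
      by (intro dvd_mult euler_summand_dvd)
  qed
  \<comment> \<open>The exponents \<open>3 * n\<close> and \<open>n * k\<close> combine to
    \<open>(k + 3) * n\<close>, so the inner sum is \<open>qfact (k + 2)\<close>; dividing by
    \<open>qfact k\<close> will leave two factors.\<close>
  also have "\<dots> = (\<Sum>k. ?d k * qfact (Suc (Suc k)))"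
  proof (rule suminf_cong)
    fix k
    have "?t n k = ?d k * (fps_X ^ (Suc (Suc (Suc k)) * n) * euler_sum 1 n)" for n
    proof -
      have "Suc (Suc (Suc k)) * n = 3 * n + n * k" by simp
      then show ?thesis
        unfolding euler_summand_def by (simp only: power_add ac_simps)
    qed
    then have "(\<Sum>n. ?t n k) = ?d k * (\<Sum>n. fps_X ^ (Suc (Suc (Suc k)) * n) * euler_sum 1 n)"
      by (simp only:) (rule fps_suminf_mult, rule X_power_mult_dvd, simp)
    then show "(\<Sum>n. ?t n k) = ?d k * qfact (Suc (Suc k))"
      by (simp only: suminf_X_power_euler_sum_1)
  qed
  also have "(\<lambda>k. ?d k * qfact (Suc (Suc k))) = (\<lambda>k. fps_const ((- z) ^ k) * fps_X ^ (Suc k choose 2)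
            * ((1 - fps_X ^ Suc k) * (1 - fps_X ^ Suc (Suc k))))"
  proof
    fix k
    have "?d k * qfact (Suc (Suc k)) = fps_const ((- z) ^ k) * fps_X ^ (Suc k choose 2)
            * (qfact k * inverse (qfact k)) * ((1 - fps_X ^ Suc k) * (1 - fps_X ^ Suc (Suc k)))"
      unfolding qfact_Suc by (simp only: ac_simps)
    then show "?d k * qfact (Suc (Suc k)) = fps_const ((- z) ^ k) * fps_X ^ (Suc k choose 2)
            * ((1 - fps_X ^ Suc k) * (1 - fps_X ^ Suc (Suc k)))"
      by (simp only: qfact_inverse mult_1_right)
  qed
  finally show ?thesis .
qed

subsection \<open>The third roots of unity\<close>

lemma omega_cube: "omega ^ 3 = 1"
  using exp_two_pi_i by (simp add: omega_def exp_of_nat_mult[symmetric] mult_ac)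

lemma omega_neq_1: "omega \<noteq> 1"
proof
  assume "omega = 1"
  then have "Re (cis (2 * pi / 3)) = 1"
    by (simp add: omega_def cis_conv_exp mult_ac)
  then show False
    by (simp add: cos_120)
qed

lemma omega_quadratic: "1 + omega + omega ^ 2 = 0"
proof -
  have "(omega - 1) * (1 + omega + omega ^ 2) = omega ^ 3 - 1"
    by (simp add: algebra_simps power2_eq_square power3_eq_cube)
  then show ?thesis
    using omega_cube omega_neq_1 by simp
qed

lemma omega_neq_0: "omega \<noteq> 0"
  using omega_cube by auto

lemma inverse_omega: "inverse omega = omega ^ 2"
  using omega_cube omega_neq_0 by (simp add: field_simps power2_eq_square power3_eq_cube)

lemma omega_powi_mod_3: "omega powi n = omega powi (n mod 3)"
proof -
  have "omega powi n = omega powi (3 * (n div 3) + n mod 3)"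
    by simp
  also have "\<dots> = (omega powi 3) powi (n div 3) * omega powi (n mod 3)"
    by (subst power_int_add) (simp_all add: omega_neq_0 power_int_mult)
  finally show ?thesis
    by (simp add: omega_cube)
qed

lemma chi3_eq: "chi3 n = (if 3 dvd n then 2 else -1)"
proof -
  have "n mod 3 \<in> {0, 1, 2}"
    by auto
  then consider "n mod 3 = 0" "- n mod 3 = 0" | "n mod 3 = 1" "- n mod 3 = 2"
    | "n mod 3 = 2" "- n mod 3 = 1"
    by (auto simp: zmod_zminus1_eq_if)
  then show ?thesis
    using omega_quadratic
    by cases (simp_all add: chi3_def omega_powi_mod_3[of n] omega_powi_mod_3[of "- n"]
                            dvd_eq_mod_eq_0 eq_neg_iff_add_eq_0 algebra_simps)
qed

lemma chi3_int: "chi3 (int k) = omega ^ k + (omega ^ 2) ^ k"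
  by (simp add: chi3_def power_int_minus power_inverse[symmetric] inverse_omega)

text \<open>Both \<open>omega\<close> and \<open>omega ^ 2\<close> are roots of
  \<open>1 + z + z^2\<close>, so three consecutive values add up to 0.\<close>

lemma chi3_rec: "chi3 (int (Suc (Suc k))) = - chi3 (int k) - chi3 (int (Suc k))"
proof -
  have "chi3 (int k) + chi3 (int (Suc k)) + chi3 (int (Suc (Suc k)))
      = omega ^ k * (1 + omega + omega ^ 2) + (omega ^ 2) ^ k * (1 + omega ^ 2 + omega * omega ^ 3)"
    by (simp only: chi3_int) (simp add: algebra_simps power2_eq_square power3_eq_cube)
  also have "\<dots> = 0"
    using omega_quadratic by (simp add: omega_cube add_ac)
  finally show ?thesis
    by algebra
qed

subsection \<open>The identity for the cubic series\<close>

lemma eps3_summand_eq: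
  "eps3_summand n = fps_X ^ (3 * n) * euler_sum 1 n * euler_sum omega n
    + fps_X ^ (3 * n) * euler_sum 1 n * euler_sum (omega ^ 2) n"
  unfolding eps3_summand_def Suc_eq_plus1[symmetric] qpoch_inf_X qpoch_inf_euler
  by (rule distrib_left)

lemma eps3_summand_dvd: "fps_X ^ n dvd eps3_summand n"
  unfolding eps3_summand_def mult.assoc by (rule X_power_mult_dvd) simp

lemma theta3_summand_dvd: "fps_X ^ n dvd theta3_summand n"
proof -
  have "n \<le> (n + 1 choose 2) + 1"
    using Suc_choose_2_ge[of n] by simp
  then show ?thesis
    unfolding theta3_summand_def by (auto intro!: dvd_mult le_imp_power_dvd simp del: power_Suc)
qed

lemma eps3_eq: "eps3 = 2 - fps_X - 2 * fps_X ^ 2 + (\<Sum>n. theta3_summand n)"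
proof -
  define Q :: "nat \<Rightarrow> complex fps" where "Q k = fps_X ^ (Suc k choose 2)" for k
  define c where "c k = fps_const ((-1) ^ k * chi3 (int k))" for k
  have Q_dvd: "fps_X ^ k dvd c j * Q (k + l)" for j k l
    unfolding Q_def using Suc_choose_2_ge[of "k + l"]
    by (intro dvd_mult le_imp_power_dvd) linarith
  note Q_dvd' = Q_dvd[of _ _ 0, simplified] Q_dvd[of _ _ 1, simplified] Q_dvd[of _ _ 2, simplified]
  \<comment> \<open>From \<open>T (k+1) = T k + k + 1\<close> it follows that
    \<open>q^(k+2) Q k\<close> is \<open>q Q (k+1)\<close> and \<open>q^(2k+3) Q k\<close> is
    \<open>Q (k+2)\<close>.\<close>
  have Q_prod: "Q k * ((1 - fps_X ^ Suc k) * (1 - fps_X ^ Suc (Suc k)))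
      = Q k - Q (Suc k) - fps_X * Q (Suc k) + Q (Suc (Suc k))" for k
    by (simp add: Q_def Suc_Suc_choose_2 power_add algebra_simps)
  have summand_dvd: "fps_X ^ k dvd fps_const a * Q k * f" for a k f
    unfolding Q_def by (intro dvd_mult2 dvd_mult le_imp_power_dvd Suc_choose_2_ge)
  have c_eq: "fps_const ((- omega) ^ k) + fps_const ((- (omega ^ 2)) ^ k) = c k" for k
    by (simp add: c_def chi3_int power_minus[of omega] power_minus[of "omega ^ 2"] distrib_left)
  \<comment> \<open>The alternating sign in \<open>c\<close> turns the sum in
    \<open>chi3_rec\<close> into a difference.\<close>
  have c_rec: "c (Suc (Suc k)) = c (Suc k) - c k" for k
    unfolding c_def chi3_rec by (simp add: algebra_simps del: of_nat_Suc)
  have c_0: "c 0 = 2" and c_1: "c (Suc 0) = 1"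
    by (simp_all add: c_def chi3_eq numeral_fps_const)

  have "eps3 = (\<Sum>n. fps_X ^ (3 * n) * euler_sum 1 n * euler_sum omega n)
      + (\<Sum>n. fps_X ^ (3 * n) * euler_sum 1 n * euler_sum (omega ^ 2) n)"
    unfolding eps3_def eps3_summand_eq
    by (rule fps_suminf_add) (unfold mult.assoc, (rule X_power_mult_dvd, simp)+)
  also have "\<dots> = (\<Sum>k. c k * (Q k - Q (Suc k) - fps_X * Q (Suc k) + Q (Suc (Suc k))))"
    unfolding suminf_euler_product Q_def[symmetric]
    by (subst fps_suminf_add[symmetric], (rule summand_dvd)+)
       (simp only: c_eq[symmetric] Q_prod[symmetric] distrib_right mult.assoc)
  also have "\<dots> = (\<Sum>k. c k * Q k) - (\<Sum>k. c k * Q (Suc k)) - fps_X * (\<Sum>k. c k * Q (Suc k))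
      + (\<Sum>k. c k * Q (Suc (Suc k)))"
  proof -
    have "c k * (Q k - Q (Suc k) - fps_X * Q (Suc k) + Q (Suc (Suc k)))
        = c k * Q k - c k * Q (Suc k) - fps_X * (c k * Q (Suc k)) + c k * Q (Suc (Suc k))" for k
      by (simp add: algebra_simps)
    then show ?thesis
      by (simp add: fps_suminf_add fps_suminf_diff fps_suminf_mult Q_dvd')
  qed
  \<comment> \<open>Heads are split off until every series runs over \<open>Q (Suc (Suc k))\<close>.
    By \<open>c_rec\<close> all series without the extra factor \<open>fps_X\<close> then
    cancel.\<close>
  also have "(\<Sum>k. c k * Q k) = 2 + fps_X + (\<Sum>k. c (Suc (Suc k)) * Q (Suc (Suc k)))"
    by (subst fps_suminf_split_head, simp add: Q_dvd', subst fps_suminf_split_head, simp add: Q_dvd')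
       (simp add: c_0 c_1 Q_def numeral_2_eq_2)
  also have "(\<Sum>k. c (Suc (Suc k)) * Q (Suc (Suc k)))
      = (\<Sum>k. c (Suc k) * Q (Suc (Suc k))) - (\<Sum>k. c k * Q (Suc (Suc k)))"
    by (simp add: fps_suminf_diff[symmetric] Q_dvd' c_rec left_diff_distrib)
  also have "(\<Sum>k. c k * Q (Suc k)) = 2 * fps_X + (\<Sum>k. c (Suc k) * Q (Suc (Suc k)))"
    by (subst fps_suminf_split_head, simp add: Q_dvd')
       (simp add: c_0 Q_def numeral_2_eq_2)
  finally have "eps3 = 2 - fps_X - 2 * fps_X ^ 2 + - fps_X * (\<Sum>k. c (Suc k) * Q (Suc (Suc k)))"
    by (simp add: algebra_simps power2_eq_square)
  also have "- fps_X * (\<Sum>k. c (Suc k) * Q (Suc (Suc k))) = (\<Sum>k. theta3_summand (Suc (Suc k)))"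
  proof -
    have "- fps_X * (c (Suc k) * Q (Suc (Suc k))) = theta3_summand (Suc (Suc k))" for k
      by (simp add: c_def Q_def theta3_summand_def fps_const_neg[symmetric] fps_const_mult[symmetric]
            fps_const_power[symmetric] algebra_simps del: fps_const_neg fps_const_mult fps_const_power)
    moreover have "(\<Sum>k. - fps_X * (c (Suc k) * Q (Suc (Suc k))))
        = - fps_X * (\<Sum>k. c (Suc k) * Q (Suc (Suc k)))"
      by (rule fps_suminf_mult) (rule Q_dvd')
    ultimately show ?thesis
      by (simp only:)
  qed
  \<comment> \<open>The summands at 0 and 1 are zero by definition, so the shift by two adds
    nothing.\<close>
  also have "\<dots> = (\<Sum>n. theta3_summand n)"
  proof -
    have "fps_X ^ n dvd theta3_summand (Suc n)" for n
      by (rule dvd_trans[OF le_imp_power_dvd theta3_summand_dvd]) simp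
    then show ?thesis
      by (simp add: fps_suminf_split_head[of theta3_summand] theta3_summand_dvd
            fps_suminf_split_head[of "\<lambda>n. theta3_summand (Suc n)"])
         (simp add: theta3_summand_def)
  qed
  finally show ?thesis .
qed

section \<open>Integrality of the coefficients\<close>

lemma theta3_summand_nth_Ints: "fps_nth (theta3_summand m) n \<in> \<int>"
proof -
  have "theta3_summand m = (if m \<ge> 2 then fps_const ((-1) ^ m * chi3 (int m - 1))
      * fps_X ^ ((m + 1 choose 2) + 1) else 0)"
    by (simp add: theta3_summand_def fps_const_neg[symmetric] fps_const_mult[symmetric]
            fps_const_power[symmetric] del: fps_const_neg fps_const_mult fps_const_power)
  then show ?thesis
    by (simp add: chi3_eq del: power_Suc)
qed

text \<open>Integrality is read off the theta side: each coefficient is a finite sum of integers,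
  since \<open>chi3\<close> takes only the values 2 and -1.\<close>

lemma E3_Ints: "E3 n \<in> \<int>"
  unfolding E3_def eps3_eq
  by (auto simp: fps_suminf_nth[OF theta3_summand_dvd] numeral_fps_const fps_X_power_iff
           intro!: Ints_add Ints_diff Ints_sum Ints_mult theta3_summand_nth_Ints)

text \<open>Infinite products and sums are total functions here, so the convergence conjuncts
  certify that \<open>qpoch_inf\<close>, \<open>eps3\<close> and the theta series are genuine
  limits.\<close>

theorem theorem1p5:
  shows "(\<forall>A :: complex fps. convergent_prod (\<lambda>i. 1 - A * fps_X ^ i))
    \<and> summable eps3_summand
    \<and> summable theta3_summand
    \<and> (\<forall>n. E3 n \<in> \<int>)
    \<and> eps3 = (\<Sum>n. fps_const (E3 n) * fps_X ^ n)
    \<and> eps3 = 2 - fps_X - 2 * fps_X ^ 2 + (\<Sum>n. theta3_summand n)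
    \<and> (\<forall>n. chi3 n = (if 3 dvd n then 2 else -1))"
  using convergent_prod_qpoch fps_summable[OF eps3_summand_dvd] fps_summable[OF theta3_summand_dvd]
    E3_Ints fps_eq_suminf_nth[of eps3] eps3_eq chi3_eq
  unfolding E3_def by blast

end
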